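(* Let $H$ be a separable right quaternionic Hilbert space and let $\Lambda=\{(W_j,\Lambda_j,v_j)\}_{j\in J}$ be a $g$-fusion frame for $H$ with respect to a family $\{H_j\}_{j\in J}$ of right quaternionic Hilbert spaces, with corresponding right $g$-fusion frame operator $S_{\mathfrak{Q}}$. Then $\Lambda$ is a Parseval $g$-fusion frame for $H$ if and only if $S_{\mathfrak{Q}}$ is the identity operator on $H$.
   Context: $\mathfrak{Q}$ denotes the real quaternions. A right quaternionic Hilbert space is a right $\mathfrak{Q}$-vector space $H$ with a map $\langle\cdot,\cdot\rangle:H\times H\to\mathfrak{Q}$ satisfying $\langle v,v\rangle>0$ for $v\neq0$, $\overline{\langle u,v\rangle}=\langle v,u\rangle$, $\langle u,v_1+v_2\rangle=\langle u,v_1\rangle+\langle u,v_2\rangle$, $\langle u,vq\rangle=\langle u,v\rangle q$ for $q\in\mathfrak{Q}$, and complete for the norm $\|u\|=\sqrt{\langle u,u\rangle}$. An operator $T$ is right linear if $T(u\alpha+v\beta)=T(u)\alpha+T(v)\beta$ for all vectors $u,v$ and $\alpha,\beta\in\mathfrak{Q}$; it is bounded if $\|Tv\|\le K\|v\|$ for some $K>0$ and all $v$; its adjoint $T^*$ is defined by $\langle v,Tu\rangle=\langle T^*v,u\rangle$. Subspaces are right $\mathfrak{Q}$-linear subspaces, and $P_W$ is the orthogonal projection of $H$ onto the closed subspace $W$. Let $J\subseteq\mathbb{Z}$, let $\{W_j\}_{j\in J}$ be closed subspaces of $H$, $\{v_j\}_{j\in J}$ positive real weights, and $\Lambda_j:H\to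 H_j$ bounded right linear operators. The family $\Lambda=\{(W_j,\Lambda_j,v_j)\}_{j\in J}$ is a $g$-fusion frame for $H$ with respect to $\{H_j\}_{j\in J}$ if there are constants (bounds) $0<A\le B<\infty$ with $$A\|f\|^2\le\sum_{j\in J}v_j^2\|\Lambda_jP_{W_j}f\|^2\le B\|f\|^2\quad\text{for all }f\in H.$$ It is a Parseval $g$-fusion frame if this holds with $A=B=1$. Its right $g$-fusion frame operator is $S_{\mathfrak{Q}}:H\to H$, $S_{\mathfrak{Q}}f=\sum_{j\in J}v_j^2P_{W_j}\Lambda_j^*\Lambda_jP_{W_j}f$ (unconditional norm convergence). *)

theory Defs
  imports "HOL-Algebra.Ring" "HOL-Analysis.Analysis"
begin

section \<open>Real quaternions\<close>

datatype quat = Quat (Re0: real) (Im1: real) (Im2: real) (Im3: real)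

lemma quat_eqI:
  "Re0 p = Re0 q \<Longrightarrow> Im1 p = Im1 q \<Longrightarrow> Im2 p = Im2 q \<Longrightarrow> Im3 p = Im3 q \<Longrightarrow> p = q"
  by (rule quat.expand) simp

lemma quat_eq_iff:
  "p = q \<longleftrightarrow> Re0 p = Re0 q \<and> Im1 p = Im1 q \<and> Im2 p = Im2 q \<and> Im3 p = Im3 q"
  by (auto intro: quat_eqI)

instantiation quat :: real_vector
begin

definition "0 = Quat 0 0 0 0"
definition "p + q = Quat (Re0 p + Re0 q) (Im1 p + Im1 q) (Im2 p + Im2 q) (Im3 p + Im3 q)"
definition "- p = Quat (- Re0 p) (- Im1 p) (- Im2 p) (- Im3 p)"
definition "p - q = Quat (Re0 p - Re0 q) (Im1 p - Im1 q) (Im2 p - Im2 q) (Im3 p - Im3 q)"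
definition "r *\<^sub>R p = Quat (r * Re0 p) (r * Im1 p) (r * Im2 p) (r * Im3 p)"

instance
  by standard
    (simp_all add: quat_eq_iff zero_quat_def plus_quat_def uminus_quat_def minus_quat_def
      scaleR_quat_def algebra_simps)

end

instantiation quat :: real_algebra_1
begin

definition "1 = Quat 1 0 0 0"
definition "p * q = Quat
  (Re0 p * Re0 q - Im1 p * Im1 q - Im2 p * Im2 q - Im3 p * Im3 q)
  (Re0 p * Im1 q + Im1 p * Re0 q + Im2 p * Im3 q - Im3 p * Im2 q)
  (Re0 p * Im2 q - Im1 p * Im3 q + Im2 p * Re0 q + Im3 p * Im1 q)
  (Re0 p * Im3 q + Im1 p * Im2 q - Im2 p * Im1 q + Im3 p * Re0 q)"

instance
  by standard
    (simp_all add: quat_eq_iff zero_quat_def one_quat_def plus_quat_def times_quat_def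
      scaleR_quat_def algebra_simps)

end

definition qcnj :: "quat \<Rightarrow> quat"
  where "qcnj q = Quat (Re0 q) (- Im1 q) (- Im2 q) (- Im3 q)"

instantiation quat :: division_ring
begin

definition "inverse q =
  (1 / ((Re0 q)\<^sup>2 + (Im1 q)\<^sup>2 + (Im2 q)\<^sup>2 + (Im3 q)\<^sup>2)) *\<^sub>R qcnj q"
definition "p div q = p * inverse (q :: quat)"

instance
proof
  fix p q :: quat
  let ?n = "(Re0 q)\<^sup>2 + (Im1 q)\<^sup>2 + (Im2 q)\<^sup>2 + (Im3 q)\<^sup>2"
  have "q * qcnj q = ?n *\<^sub>R 1" and "qcnj q * q = ?n *\<^sub>R 1"
    by (simp_all add: quat_eq_iff times_quat_def qcnj_def one_quat_def scaleR_quat_def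
        power2_eq_square algebra_simps)
  moreover have "?n \<noteq> 0" if "q \<noteq> 0"
  proof
    assume "?n = 0"
    moreover have "0 \<le> (Re0 q)\<^sup>2" "0 \<le> (Im1 q)\<^sup>2" "0 \<le> (Im2 q)\<^sup>2" "0 \<le> (Im3 q)\<^sup>2"
      by simp_all
    ultimately have "(Re0 q)\<^sup>2 = 0" "(Im1 q)\<^sup>2 = 0" "(Im2 q)\<^sup>2 = 0" "(Im3 q)\<^sup>2 = 0"
      by linarith+
    with that show False
      by (simp add: quat_eq_iff zero_quat_def)
  qed
  ultimately show "q \<noteq> 0 \<Longrightarrow> inverse q * q = 1" and "q \<noteq> 0 \<Longrightarrow> q * inverse q = 1"
    by (simp_all add: inverse_quat_def)
  show "p div q = p * inverse q"
    by (rule divide_quat_def)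
  show "inverse (0 :: quat) = 0"
    by (simp add: inverse_quat_def qcnj_def quat_eq_iff scaleR_quat_def zero_quat_def)
qed

end


section \<open>Right quaternionic Hilbert spaces\<close>

text \<open>
  As with modules in HOL-Algebra, the additive group is carried by a ring record whose
  multiplicative fields are irrelevant; this makes \<^const>\<open>finsum\<close> available. The spaces have
  explicit carriers, so that a family of Hilbert spaces indexed by a set need not consist of
  copies of a single one.
\<close>

record 'a right_qspace = "'a ring" +
  rsmult :: "'a \<Rightarrow> quat \<Rightarrow> 'a"  (infixl \<open>\<odot>\<^sub>r\<index>\<close> 70)
  qinner :: "'a \<Rightarrow> 'a \<Rightarrow> quat"

definition qnorm :: "('a, 'm) right_qspace_scheme \<Rightarrow> 'a \<Rightarrow> real"
  where "qnorm H u = sqrt (Re0 (qinner H u u))"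

text \<open>
  The value 0 off the carrier is there because \<^locale>\<open>Metric_space\<close> demands symmetry and
  nonnegativity of a distance on the whole type.
\<close>

definition qdist :: "('a, 'm) right_qspace_scheme \<Rightarrow> 'a \<Rightarrow> 'a \<Rightarrow> real"
  where "qdist H u v =
    (if u \<in> carrier H \<and> v \<in> carrier H then qnorm H (u \<ominus>\<^bsub>H\<^esub> v) else 0)"

definition qtopology :: "('a, 'm) right_qspace_scheme \<Rightarrow> 'a topology"
  where "qtopology H = Metric_space.mtopology (carrier H) (qdist H)"

locale right_quaternionic_hilbert_space = abelian_group H for H (structure) +
  assumes rsmult_closed: "u \<in> carrier H \<Longrightarrow> u \<odot>\<^sub>r p \<in> carrier H"
    and rsmult_add_left:
      "u \<in> carrier H \<Longrightarrow> v \<in> carrier H \<Longrightarrow> (u \<oplus> v) \<odot>\<^sub>r p = u \<odot>\<^sub>r p \<oplus> v \<odot>\<^sub>r p"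
    and rsmult_add_right: "u \<in> carrier H \<Longrightarrow> u \<odot>\<^sub>r (p + q) = u \<odot>\<^sub>r p \<oplus> u \<odot>\<^sub>r q"
    and rsmult_assoc: "u \<in> carrier H \<Longrightarrow> u \<odot>\<^sub>r (p * q) = u \<odot>\<^sub>r p \<odot>\<^sub>r q"
    and rsmult_one: "u \<in> carrier H \<Longrightarrow> u \<odot>\<^sub>r 1 = u"
    and qinner_pos: "u \<in> carrier H \<Longrightarrow> u \<noteq> \<zero> \<Longrightarrow> \<exists>r>0. qinner H u u = of_real r"
    and qinner_cnj:
      "u \<in> carrier H \<Longrightarrow> v \<in> carrier H \<Longrightarrow> qcnj (qinner H u v) = qinner H v u"
    and qinner_add_right:
      "u \<in> carrier H \<Longrightarrow> v \<in> carrier H \<Longrightarrow> w \<in> carrier H \<Longrightarrow>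
        qinner H u (v \<oplus> w) = qinner H u v + qinner H u w"
    and qinner_rsmult_right:
      "u \<in> carrier H \<Longrightarrow> v \<in> carrier H \<Longrightarrow> qinner H u (v \<odot>\<^sub>r q) = qinner H u v * q"
    and complete: "Metric_space.mcomplete (carrier H) (qdist H)"

definition bounded_right_linear ::
    "('a, 'm) right_qspace_scheme \<Rightarrow> ('b, 'n) right_qspace_scheme \<Rightarrow> ('a \<Rightarrow> 'b) \<Rightarrow> bool"
  where "bounded_right_linear H K T \<longleftrightarrow>
    T \<in> carrier H \<rightarrow> carrier K \<and>
    (\<forall>u\<in>carrier H. \<forall>v\<in>carrier H. \<forall>\<alpha> \<beta>.
      T (u \<odot>\<^sub>r\<^bsub>H\<^esub> \<alpha> \<oplus>\<^bsub>H\<^esub> v \<odot>\<^sub>r\<^bsub>H\<^esub> \<beta>) = T u \<odot>\<^sub>r\<^bsub>K\<^esub> \<alpha> \<oplus>\<^bsub>K\<^esub> T v \<odot>\<^sub>r\<^bsub>K\<^esub> \<beta>) \<and>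
    (\<exists>C>0. \<forall>v\<in>carrier H. qnorm K (T v) \<le> C * qnorm H v)"

definition qadjoint ::
    "('a, 'm) right_qspace_scheme \<Rightarrow> ('b, 'n) right_qspace_scheme \<Rightarrow> ('a \<Rightarrow> 'b) \<Rightarrow> 'b \<Rightarrow> 'a"
  where "qadjoint H K T v =
    (THE w. w \<in> carrier H \<and> (\<forall>u\<in>carrier H. qinner K v (T u) = qinner H w u))"

definition closed_right_subspace :: "('a, 'm) right_qspace_scheme \<Rightarrow> 'a set \<Rightarrow> bool"
  where "closed_right_subspace H W \<longleftrightarrow>
    W \<subseteq> carrier H \<and> \<zero>\<^bsub>H\<^esub> \<in> W \<and>
    (\<forall>u\<in>W. \<forall>v\<in>W. u \<oplus>\<^bsub>H\<^esub> v \<in> W) \<and>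
    (\<forall>u\<in>W. \<forall>q. u \<odot>\<^sub>r\<^bsub>H\<^esub> q \<in> W) \<and>
    closedin (qtopology H) W"

definition qproj :: "('a, 'm) right_qspace_scheme \<Rightarrow> 'a set \<Rightarrow> 'a \<Rightarrow> 'a"
  where "qproj H W f = (THE w. w \<in> W \<and> (\<forall>u\<in>W. qinner H u (f \<ominus>\<^bsub>H\<^esub> w) = 0))"

text \<open>Unconditional norm convergence: the net of finite partial sums converges.\<close>

definition qhas_sum ::
    "('a, 'm) right_qspace_scheme \<Rightarrow> ('i \<Rightarrow> 'a) \<Rightarrow> 'i set \<Rightarrow> 'a \<Rightarrow> bool"
  where "qhas_sum H x I s \<longleftrightarrow>
    limitin (qtopology H) (\<lambda>F. finsum H x F) s (finite_subsets_at_top I)"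


section \<open>g-fusion frames\<close>

definition g_fusion_family ::
    "('a, 'm) right_qspace_scheme \<Rightarrow> int set \<Rightarrow> (int \<Rightarrow> ('b, 'n) right_qspace_scheme) \<Rightarrow>
     (int \<Rightarrow> 'a set) \<Rightarrow> (int \<Rightarrow> 'a \<Rightarrow> 'b) \<Rightarrow> (int \<Rightarrow> real) \<Rightarrow> bool"
  where "g_fusion_family H J K W \<Lambda> v \<longleftrightarrow>
    (\<forall>j\<in>J. closed_right_subspace H (W j) \<and> bounded_right_linear H (K j) (\<Lambda> j) \<and> 0 < v j)"

definition g_fusion_bounds ::
    "('a, 'm) right_qspace_scheme \<Rightarrow> int set \<Rightarrow> (int \<Rightarrow> ('b, 'n) right_qspace_scheme) \<Rightarrow>
     (int \<Rightarrow> 'a set) \<Rightarrow> (int \<Rightarrow> 'a \<Rightarrow> 'b) \<Rightarrow> (int \<Rightarrow> real) \<Rightarrow> real \<Rightarrow> real \<Rightarrow> bool"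
  where "g_fusion_bounds H J K W \<Lambda> v A B \<longleftrightarrow>
    (\<forall>f\<in>carrier H. \<exists>s.
      ((\<lambda>j. (v j)\<^sup>2 * (qnorm (K j) (\<Lambda> j (qproj H (W j) f)))\<^sup>2) has_sum s) J \<and>
      A * (qnorm H f)\<^sup>2 \<le> s \<and> s \<le> B * (qnorm H f)\<^sup>2)"

definition g_fusion_frame ::
    "('a, 'm) right_qspace_scheme \<Rightarrow> int set \<Rightarrow> (int \<Rightarrow> ('b, 'n) right_qspace_scheme) \<Rightarrow>
     (int \<Rightarrow> 'a set) \<Rightarrow> (int \<Rightarrow> 'a \<Rightarrow> 'b) \<Rightarrow> (int \<Rightarrow> real) \<Rightarrow> bool"
  where "g_fusion_frame H J K W \<Lambda> v \<longleftrightarrow>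
    g_fusion_family H J K W \<Lambda> v \<and>
    (\<exists>A B. 0 < A \<and> A \<le> B \<and> g_fusion_bounds H J K W \<Lambda> v A B)"

definition parseval_g_fusion_frame ::
    "('a, 'm) right_qspace_scheme \<Rightarrow> int set \<Rightarrow> (int \<Rightarrow> ('b, 'n) right_qspace_scheme) \<Rightarrow>
     (int \<Rightarrow> 'a set) \<Rightarrow> (int \<Rightarrow> 'a \<Rightarrow> 'b) \<Rightarrow> (int \<Rightarrow> real) \<Rightarrow> bool"
  where "parseval_g_fusion_frame H J K W \<Lambda> v \<longleftrightarrow>
    g_fusion_family H J K W \<Lambda> v \<and> g_fusion_bounds H J K W \<Lambda> v 1 1"

definition g_fusion_frame_operator ::
    "('a, 'm) right_qspace_scheme \<Rightarrow> int set \<Rightarrow> (int \<Rightarrow> ('b, 'n) right_qspace_scheme) \<Rightarrow>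
     (int \<Rightarrow> 'a set) \<Rightarrow> (int \<Rightarrow> 'a \<Rightarrow> 'b) \<Rightarrow> (int \<Rightarrow> real) \<Rightarrow> 'a \<Rightarrow> 'a"
  where "g_fusion_frame_operator H J K W \<Lambda> v f =
    (THE g. qhas_sum H
      (\<lambda>j. qproj H (W j) (qadjoint H (K j) (\<Lambda> j) (\<Lambda> j (qproj H (W j) f)))
             \<odot>\<^sub>r\<^bsub>H\<^esub> of_real ((v j)\<^sup>2))
      J g)"

end

theory Submission
  imports Defs
begin

text \<open>
  Write \<open>T\<^sub>j = v\<^sub>j\<^sup>2 P\<^sub>j \<Lambda>\<^sub>j\<^sup>* \<Lambda>\<^sub>j P\<^sub>j\<close>, \<open>S\<^sub>F = \<Sum>j\<in>F. T\<^sub>j\<close> for finite \<open>F \<subseteq> J\<close>, and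
  \<open>e\<^sub>j f = v\<^sub>j\<^sup>2 \<parallel>\<Lambda>\<^sub>j P\<^sub>j f\<parallel>\<^sup>2\<close>. Orthogonal projections are symmetric and \<open>\<Lambda>\<^sub>j\<^sup>*\<close> is an adjoint, so the real
  part of \<open>\<langle>g, T\<^sub>j f\<rangle>\<close> is that of \<open>v\<^sub>j\<^sup>2 \<langle>\<Lambda>\<^sub>j P\<^sub>j g, \<Lambda>\<^sub>j P\<^sub>j f\<rangle>\<close>; in particular it is \<open>e\<^sub>j f\<close> for \<open>g = f\<close>.

  The upper frame bound \<open>B\<close> controls partial sums. With \<open>x = S\<^sub>F f\<close>, the identity above and the
  Cauchy-Schwarz inequality give \<open>\<parallel>x\<parallel>\<^sup>4 \<le> (\<Sum>j\<in>F. e\<^sub>j x) (\<Sum>j\<in>F. e\<^sub>j f) \<le> B \<parallel>x\<parallel>\<^sup>2 (\<Sum>j\<in>F. e\<^sub>j f)\<close>, hence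
  \<open>\<parallel>S\<^sub>F f\<parallel>\<^sup>2 \<le> B (\<Sum>j\<in>F. e\<^sub>j f)\<close>; this is \<open>partial_sum_bound\<close>. Applied to sets \<open>F\<close> far out in \<open>J\<close> it
  shows that the series for \<open>S f\<close> is Cauchy, so \<open>S f\<close> really is its sum and
  \<open>Re \<langle>f, S f\<rangle> = \<Sum>j\<in>J. e\<^sub>j f\<close>. If \<open>S\<close> is the identity, this sum is \<open>\<parallel>f\<parallel>\<^sup>2\<close>, which is the Parseval
  property.

  Conversely, a Parseval system has \<open>B = 1\<close>, and then
  \<open>\<parallel>S\<^sub>F f - f\<parallel>\<^sup>2 = \<parallel>S\<^sub>F f\<parallel>\<^sup>2 - 2 (\<Sum>j\<in>F. e\<^sub>j f) + \<parallel>f\<parallel>\<^sup>2 \<le> \<parallel>f\<parallel>\<^sup>2 - (\<Sum>j\<in>F. e\<^sub>j f)\<close>, which tends to 0. Hence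
  \<open>S f = f\<close> directly, without polarisation.

  The existence of projections and adjoints comes from one variational argument,
  \<open>real_functional_representation\<close>. Throughout, only the real part of the inner product is used
  where possible: it is a real inner product with the same norm, and it determines the
  quaternionic one because the right factor can be multiplied by any quaternion.
\<close>

section \<open>Inner products, norms and distances\<close>

lemma linear_coefficient_zero_of_nonneg:
  fixes a b :: real
  assumes "\<And>t. 0 \<le> t * a + t\<^sup>2 * b"
  shows "a = 0"
proof (rule ccontr)
  assume "a \<noteq> 0"
  define c where "c = \<bar>b\<bar> + 1"
  have c: "c > 0" "b < c" by (auto simp: c_def)
  \<comment> \<open>Near \<open>t = 0\<close> the linear term dominates: this \<open>t\<close> is small enough and of sign opposite to \<open>a\<close>.\<close>
  have "0 \<le> (- a / c) * a + (- a / c)\<^sup>2 * b" by (rule assms)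
  also have "\<dots> = (a\<^sup>2 / c\<^sup>2) * (b - c)"
    using c(1) by (simp add: field_simps power2_eq_square)
  also have "\<dots> < 0"
    using c \<open>a \<noteq> 0\<close> by (intro mult_pos_neg) auto
  finally show False by simp
qed

text \<open>
  Multiplying by the quaternion units moves each component, up to sign, into the real part.
\<close>

lemma quat_eqI_Re0_mult:
  assumes "\<And>q. Re0 (p * q) = Re0 (p' * q)"
  shows "p = p'"
  using assms[of "Quat 1 0 0 0"] assms[of "Quat 0 1 0 0"] assms[of "Quat 0 0 1 0"]
    assms[of "Quat 0 0 0 1"]
  by (simp add: quat_eq_iff times_quat_def)

lemma Re0_add [simp]: "Re0 (p + q) = Re0 p + Re0 q"
  by (simp add: plus_quat_def)

lemma Re0_diff [simp]: "Re0 (p - q) = Re0 p - Re0 q"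
  by (simp add: minus_quat_def)

lemma Re0_uminus [simp]: "Re0 (- p) = - Re0 p"
  by (simp add: uminus_quat_def)

lemma Re0_zero [simp]: "Re0 0 = 0"
  by (simp add: zero_quat_def)

lemma Re0_of_real [simp]: "Re0 (of_real r) = r"
  by (simp add: of_real_def scaleR_quat_def one_quat_def)

lemma Re0_mult_of_real [simp]: "Re0 (p * of_real r) = Re0 p * r"
  by (simp add: of_real_def scaleR_quat_def one_quat_def times_quat_def)

lemma Re0_qcnj [simp]: "Re0 (qcnj p) = Re0 p"
  by (simp add: qcnj_def)

abbreviation rinner :: "('a, 'm) right_qspace_scheme \<Rightarrow> 'a \<Rightarrow> 'a \<Rightarrow> real"
  where "rinner H u v \<equiv> Re0 (qinner H u v)"

context right_quaternionic_hilbert_space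
begin

lemma qinner_zero_right [simp]: "u \<in> carrier H \<Longrightarrow> qinner H u \<zero> = 0"
  using qinner_add_right[of u \<zero> \<zero>] by simp

lemma qinner_diff_right:
  assumes "u \<in> carrier H" "v \<in> carrier H" "w \<in> carrier H"
  shows "qinner H u (v \<ominus> w) = qinner H u v - qinner H u w"
proof -
  have "qinner H u (\<ominus> w) + qinner H u w = 0"
    using qinner_add_right[of u "\<ominus> w" w] assms by (simp add: l_neg)
  then show ?thesis
    using qinner_add_right[of u v "\<ominus> w"] assms by (simp add: minus_eq eq_neg_iff_add_eq_0)
qed

lemma rinner_commute: "u \<in> carrier H \<Longrightarrow> v \<in> carrier H \<Longrightarrow> rinner H u v = rinner H v u"
  by (metis qinner_cnj Re0_qcnj)

lemma rinner_add_left: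
  "u \<in> carrier H \<Longrightarrow> v \<in> carrier H \<Longrightarrow> w \<in> carrier H \<Longrightarrow>
    rinner H (u \<oplus> v) w = rinner H u w + rinner H v w"
  by (simp add: rinner_commute[of _ w] qinner_add_right)

lemma rinner_diff_left:
  "u \<in> carrier H \<Longrightarrow> v \<in> carrier H \<Longrightarrow> w \<in> carrier H \<Longrightarrow>
    rinner H (u \<ominus> v) w = rinner H u w - rinner H v w"
  by (simp add: rinner_commute[of _ w] qinner_diff_right)

lemma rinner_rsmult_left:
  "u \<in> carrier H \<Longrightarrow> v \<in> carrier H \<Longrightarrow> rinner H (u \<odot>\<^sub>r of_real r) v = r * rinner H u v"
  by (simp add: rinner_commute[of _ v] qinner_rsmult_right rsmult_closed)

lemmas rinner_simps = qinner_add_right qinner_diff_right qinner_rsmult_right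
  rinner_add_left rinner_diff_left rinner_rsmult_left rsmult_closed

lemma rinner_self_nonneg: "u \<in> carrier H \<Longrightarrow> 0 \<le> rinner H u u"
  using qinner_pos[of u] by (cases "u = \<zero>") auto

lemma rinner_self_eq_0_iff: "u \<in> carrier H \<Longrightarrow> rinner H u u = 0 \<longleftrightarrow> u = \<zero>"
  using qinner_pos[of u] by (cases "u = \<zero>") auto

lemma qnorm_power2: "u \<in> carrier H \<Longrightarrow> (qnorm H u)\<^sup>2 = rinner H u u"
  by (simp add: qnorm_def rinner_self_nonneg)

lemma qnorm_nonneg: "u \<in> carrier H \<Longrightarrow> 0 \<le> qnorm H u"
  by (simp add: qnorm_def rinner_self_nonneg)

lemma qnorm_add_power2:
  "u \<in> carrier H \<Longrightarrow> v \<in> carrier H \<Longrightarrow>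
    (qnorm H (u \<oplus> v))\<^sup>2 = (qnorm H u)\<^sup>2 + 2 * rinner H u v + (qnorm H v)\<^sup>2"
  by (simp add: qnorm_power2 rinner_simps rinner_commute[of v u])

lemma qnorm_diff_power2:
  "u \<in> carrier H \<Longrightarrow> v \<in> carrier H \<Longrightarrow>
    (qnorm H (u \<ominus> v))\<^sup>2 = (qnorm H u)\<^sup>2 - 2 * rinner H u v + (qnorm H v)\<^sup>2"
  by (simp add: qnorm_power2 rinner_simps rinner_commute[of v u])

lemma qnorm_rsmult_power2:
  "u \<in> carrier H \<Longrightarrow> (qnorm H (u \<odot>\<^sub>r of_real r))\<^sup>2 = r\<^sup>2 * (qnorm H u)\<^sup>2"
  by (simp add: qnorm_power2 rinner_simps) (simp add: power2_eq_square)

lemma rinner_Cauchy_Schwarz: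
  assumes u: "u \<in> carrier H" and v: "v \<in> carrier H"
  shows "\<bar>rinner H u v\<bar> \<le> qnorm H u * qnorm H v"
proof (cases "v = \<zero>")
  case True
  then show ?thesis using u by (simp add: qnorm_def)
next
  case False
  define a b s where "a = rinner H u u" and "b = rinner H v v" and "s = rinner H u v"
  have b: "b > 0"
    using False v rinner_self_nonneg[of v] rinner_self_eq_0_iff[of v] by (simp add: b_def)
  \<comment> \<open>\<open>b\<close> times the component of \<open>u\<close> orthogonal to \<open>v\<close>, scaled to avoid division.\<close>
  have "0 \<le> (qnorm H (u \<odot>\<^sub>r of_real b \<ominus> v \<odot>\<^sub>r of_real s))\<^sup>2" by simp
  also have "\<dots> = b * (a * b - s\<^sup>2)"
    using u v
    by (simp add: qnorm_power2 rinner_simps rinner_commute[of v u] a_def b_def s_def)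
      (simp add: power2_eq_square algebra_simps)
  finally have "s\<^sup>2 \<le> a * b" using b by (simp add: zero_le_mult_iff)
  then have "s\<^sup>2 \<le> (qnorm H u * qnorm H v)\<^sup>2"
    using u v by (simp add: power_mult_distrib qnorm_power2 a_def b_def)
  then show ?thesis
    using abs_le_square_iff[of s "qnorm H u * qnorm H v"] qnorm_nonneg u v
    by (simp add: s_def abs_mult)
qed

lemma qnorm_triangle:
  assumes u: "u \<in> carrier H" and v: "v \<in> carrier H"
  shows "qnorm H (u \<oplus> v) \<le> qnorm H u + qnorm H v"
proof (rule power2_le_imp_le)
  show "(qnorm H (u \<oplus> v))\<^sup>2 \<le> (qnorm H u + qnorm H v)\<^sup>2"
    using rinner_Cauchy_Schwarz[OF u v] u v by (simp add: qnorm_add_power2 power2_sum)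
qed (use u v qnorm_nonneg in simp)

lemma add_diff_cancel_mid:
  assumes "u \<in> carrier H" "v \<in> carrier H" "w \<in> carrier H"
  shows "(u \<ominus> v) \<oplus> (v \<ominus> w) = u \<ominus> w"
  using assms by (simp add: minus_eq a_assoc r_neg2 r_neg1)

lemma rsmult_zero: "u \<in> carrier H \<Longrightarrow> u \<odot>\<^sub>r 0 = \<zero>"
  using rsmult_add_right[of u 0 0] by (simp add: rsmult_closed)

lemma rsmult_minus_one: "u \<in> carrier H \<Longrightarrow> u \<odot>\<^sub>r (- 1) = \<ominus> u"
  using rsmult_add_right[of u "- 1" 1]
  by (intro minus_equality[symmetric]) (simp_all add: rsmult_zero rsmult_one rsmult_closed)

lemma closed_right_subspace_diff:
  assumes "closed_right_subspace H W" "u \<in> W" "v \<in> W"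
  shows "u \<ominus> v \<in> W"
proof -
  have "v \<in> carrier H" "u \<oplus> v \<odot>\<^sub>r (- 1) \<in> W"
    using assms by (auto simp: closed_right_subspace_def)
  then show ?thesis by (simp add: minus_eq rsmult_minus_one)
qed

lemma qnorm_diff_eq_0_iff:
  assumes "u \<in> carrier H" "v \<in> carrier H"
  shows "qnorm H (u \<ominus> v) = 0 \<longleftrightarrow> u = v"
proof -
  have "qnorm H (u \<ominus> v) = 0 \<longleftrightarrow> u \<ominus> v = \<zero>"
    using assms rinner_self_eq_0_iff[of "u \<ominus> v"] by (simp add: qnorm_def)
  also have "\<dots> \<longleftrightarrow> u = v"
    using assms by (metis minus_eq r_neg minus_equality minus_minus a_inv_closed)
  finally show ?thesis .
qed

lemma qnorm_diff_commute:
  assumes "u \<in> carrier H" "v \<in> carrier H"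
  shows "qnorm H (u \<ominus> v) = qnorm H (v \<ominus> u)"
proof (rule power2_eq_imp_eq)
  show "(qnorm H (u \<ominus> v))\<^sup>2 = (qnorm H (v \<ominus> u))\<^sup>2"
    using assms by (simp add: qnorm_diff_power2 rinner_commute[of v u])
qed (use assms qnorm_nonneg in auto)

lemma Metric_space_qdist: "Metric_space (carrier H) (qdist H)"
proof
  fix x y z
  show "0 \<le> qdist H x y" "qdist H x y = qdist H y x"
    by (simp_all add: qdist_def qnorm_nonneg qnorm_diff_commute)
  assume xy: "x \<in> carrier H" "y \<in> carrier H"
  then show "qdist H x y = 0 \<longleftrightarrow> x = y"
    by (simp add: qdist_def qnorm_diff_eq_0_iff)
  assume "z \<in> carrier H"
  with xy show "qdist H x z \<le> qdist H x y + qdist H y z"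
    using qnorm_triangle[of "x \<ominus> y" "y \<ominus> z"] by (simp add: qdist_def add_diff_cancel_mid)
qed

sublocale metric: Metric_space "carrier H" "qdist H"
  by (rule Metric_space_qdist)

lemma closed_right_subspace_carrier: "closed_right_subspace H (carrier H)"
  using closedin_topspace[of metric.mtopology]
  by (simp add: closed_right_subspace_def qtopology_def rsmult_closed)

lemma limitin_qtopology_iff:
  "limitin (qtopology H) x l F \<longleftrightarrow>
    l \<in> carrier H \<and> (\<forall>\<epsilon>>0. \<forall>\<^sub>F n in F. x n \<in> carrier H \<and> qdist H (x n) l < \<epsilon>)"
  by (simp add: qtopology_def metric.limitin_metric)

lemma limitin_qtopology_unique:
  "limitin (qtopology H) x l F \<Longrightarrow> limitin (qtopology H) x l' F \<Longrightarrow> F \<noteq> bot \<Longrightarrow> l = l'"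
  by (simp add: qtopology_def metric.limitin_metric_unique)

text \<open>
  Squared distances are what both applications estimate: the parallelogram law bounds them along a
  minimising sequence, and the frame bound along the partial sums of the frame series.
\<close>

lemma limit_of_fast_Cauchy:
  fixes x :: "nat \<Rightarrow> 'a"
  assumes x: "\<And>n. x n \<in> carrier H"
    and bound: "\<And>n k. (qdist H (x n) (x k))\<^sup>2 \<le> 2 / real (Suc n) + 2 / real (Suc k)"
  obtains l where "limitin (qtopology H) x l sequentially"
proof -
  have "metric.MCauchy x"
    unfolding metric.MCauchy_def
  proof (intro conjI allI impI)
    show "range x \<subseteq> carrier H" using x by auto
    fix \<epsilon> :: real assume \<epsilon>: "\<epsilon> > 0"
    obtain N where N: "inverse (real (Suc N)) < \<epsilon>\<^sup>2 / 4"
      using reals_Archimedean[of "\<epsilon>\<^sup>2 / 4"] \<epsilon> by auto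
    show "\<exists>N. \<forall>n n'. N \<le> n \<longrightarrow> N \<le> n' \<longrightarrow> qdist H (x n) (x n') < \<epsilon>"
    proof (intro exI allI impI)
      fix n n' assume n: "N \<le> n" "N \<le> n'"
      have "2 / real (Suc n) \<le> 2 / real (Suc N)" "2 / real (Suc n') \<le> 2 / real (Suc N)"
        using n by (auto intro!: divide_left_mono)
      with bound[of n n'] have "(qdist H (x n) (x n'))\<^sup>2 \<le> 2 / real (Suc N) + 2 / real (Suc N)"
        by linarith
      then have "(qdist H (x n) (x n'))\<^sup>2 \<le> 4 * inverse (real (Suc N))"
        by (simp add: divide_inverse)
      also have "\<dots> < \<epsilon>\<^sup>2" using N by simp
      finally show "qdist H (x n) (x n') < \<epsilon>"
        using \<epsilon> by (simp add: power_less_imp_less_base)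
    qed
  qed
  then show thesis
    using complete that by (auto simp: metric.mcomplete_def qtopology_def)
qed

end

section \<open>Orthogonal projections and adjoints\<close>

context right_quaternionic_hilbert_space
begin

text \<open>
  The function \<open>\<lambda>w. (qnorm H w)\<^sup>2 - 2 * \<phi> w\<close> is bounded below, and the parallelogram law makes
  every minimising sequence in \<open>W\<close> Cauchy. At the minimiser the first variation vanishes, which
  is the asserted representation. Taking \<open>\<phi> = rinner H f\<close> yields the orthogonal projection of
  \<open>f\<close>; taking \<open>W = carrier H\<close> yields the Riesz vector needed for adjoints.
\<close>

lemma real_functional_representation:
  assumes W: "closed_right_subspace H W"
    and add: "\<And>u v. u \<in> W \<Longrightarrow> v \<in> W \<Longrightarrow> \<phi> (u \<oplus> v) = \<phi> u + \<phi> v"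
    and scale: "\<And>u r. u \<in> W \<Longrightarrow> \<phi> (u \<odot>\<^sub>r of_real r) = r * \<phi> u"
    and bounded: "\<And>u. u \<in> W \<Longrightarrow> \<bar>\<phi> u\<bar> \<le> C * qnorm H u"
  shows "\<exists>w\<in>W. \<forall>u\<in>W. rinner H w u = \<phi> u"
proof -
  have WH: "\<And>u. u \<in> W \<Longrightarrow> u \<in> carrier H" and W0: "\<zero> \<in> W"
    and Wadd: "\<And>u v. u \<in> W \<Longrightarrow> v \<in> W \<Longrightarrow> u \<oplus> v \<in> W"
    and Wsm: "\<And>u q. u \<in> W \<Longrightarrow> u \<odot>\<^sub>r q \<in> W"
    and Wcl: "closedin metric.mtopology W"
    using W by (auto simp: closed_right_subspace_def qtopology_def)
  define E where "E w = (qnorm H w)\<^sup>2 - 2 * \<phi> w" for w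
  have E_step: "E (x \<oplus> u \<odot>\<^sub>r of_real t)
      = E x + t * (2 * (rinner H x u - \<phi> u)) + t\<^sup>2 * (qnorm H u)\<^sup>2"
    if "x \<in> W" "u \<in> W" for x u t
    using that WH
    by (simp add: E_def add scale Wsm qnorm_add_power2 qnorm_rsmult_power2 rsmult_closed
        qinner_rsmult_right algebra_simps)
  have lower: "- C\<^sup>2 \<le> E w" if "w \<in> W" for w
  proof -
    have "0 \<le> (qnorm H w - C)\<^sup>2" by simp
    then show ?thesis
      using bounded[OF that] by (simp add: E_def power2_diff abs_le_iff algebra_simps)
  qed
  define m where "m = Inf (E ` W)"
  have bdd: "bdd_below (E ` W)" using lower by (auto intro!: bdd_belowI)
  have m_le: "m \<le> E w" if "w \<in> W" for w
    using bdd that by (auto simp: m_def intro: cInf_lower)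
  have "\<exists>w\<in>W. E w < m + 1 / (2 * real (Suc n))" for n
    using cInf_lessD[of "E ` W" "m + 1 / (2 * real (Suc n))"] W0
    by (auto simp: m_def)
  then obtain x where xW: "\<And>n. x n \<in> W" and xE: "\<And>n. E (x n) < m + 1 / (2 * real (Suc n))"
    by metis
  \<comment> \<open>Parallelogram law, with \<open>E\<close> at the midpoint bounded below by the infimum.\<close>
  have gap: "(qnorm H (u \<ominus> v))\<^sup>2 \<le> 2 * (E u - m) + 2 * (E v - m)" if "u \<in> W" "v \<in> W" for u v
  proof -
    have "m \<le> E ((u \<oplus> v) \<odot>\<^sub>r of_real (1/2))"
      using that by (simp add: m_le Wadd Wsm del: of_real_divide)
    also have "\<dots> = (qnorm H (u \<oplus> v))\<^sup>2 / 4 - \<phi> u - \<phi> v"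
      using that WH unfolding E_def
      by (subst qnorm_rsmult_power2, simp, subst scale, simp add: Wadd)
         (simp add: add power2_eq_square field_simps)
    finally have "4 * m \<le> (qnorm H (u \<oplus> v))\<^sup>2 - 4 * \<phi> u - 4 * \<phi> v" by linarith
    moreover have "(qnorm H (u \<ominus> v))\<^sup>2 = 2 * (qnorm H u)\<^sup>2 + 2 * (qnorm H v)\<^sup>2 - (qnorm H (u \<oplus> v))\<^sup>2"
      using that WH by (simp add: qnorm_add_power2 qnorm_diff_power2)
    ultimately show ?thesis by (simp add: E_def algebra_simps)
  qed
  have dist: "qdist H (x n) (x k) = qnorm H (x n \<ominus> x k)" for n k
    using xW WH by (simp add: qdist_def)
  have "(qdist H (x n) (x k))\<^sup>2 \<le> 2 / real (Suc n) + 2 / real (Suc k)" for n k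
  proof -
    have "E (x n) - m \<le> 1 / real (Suc n)" for n
    proof -
      have "1 / (2 * real (Suc n)) \<le> 1 / real (Suc n)" by (simp add: field_simps)
      with xE[of n] show ?thesis by linarith
    qed
    from this[of n] this[of k] show ?thesis
      using gap[OF xW[of n] xW[of k]] unfolding dist by simp
  qed
  then obtain w where lim: "limitin (qtopology H) x w sequentially"
    using limit_of_fast_Cauchy[of x] xW WH by blast
  have w: "w \<in> W"
    using Wcl lim xW unfolding metric.metric_closedin_iff_sequentially_closed qtopology_def
    by blast
  \<comment> \<open>The infimum is attained at the limit.\<close>
  have dist0: "(\<lambda>n. qnorm H (x n \<ominus> w)) \<longlonglongrightarrow> 0"
  proof (rule order_tendstoI)
    fix a :: real assume "a < 0"
    then show "\<forall>\<^sub>F n in sequentially. a < qnorm H (x n \<ominus> w)"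
      using qnorm_nonneg xW WH w by (auto intro!: always_eventually less_le_trans[of a 0])
  next
    fix a :: real assume "0 < a"
    then show "\<forall>\<^sub>F n in sequentially. qnorm H (x n \<ominus> w) < a"
      using lim xW WH w by (auto simp: limitin_qtopology_iff qdist_def)
  qed
  have "E w \<le> m + 1 / (2 * real (Suc n)) + 2 * ((qnorm H w + C) * qnorm H (x n \<ominus> w))" for n
  proof -
    define d where "d = x n \<ominus> w"
    have d: "d \<in> W" using closed_right_subspace_diff[OF W xW w] by (simp add: d_def)
    have "x n = w \<oplus> d"
      using xW[of n] w WH by (simp add: d_def minus_eq r_neg2 a_comm[of "x n"])
    then have "x n = w \<oplus> d \<odot>\<^sub>r of_real 1" using d WH by (simp add: rsmult_one)
    then have "E (x n) = E w + 2 * (rinner H w d - \<phi> d) + (qnorm H d)\<^sup>2"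
      using E_step[OF w d, of 1] by simp
    moreover have "\<bar>rinner H w d\<bar> \<le> qnorm H w * qnorm H d"
      using w d WH by (intro rinner_Cauchy_Schwarz) auto
    ultimately have "E w \<le> E (x n) + 2 * ((qnorm H w + C) * qnorm H d)"
      using bounded[OF d] zero_le_power2[of "qnorm H d"] 
      unfolding distrib_left distrib_right right_diff_distrib by linarith
    also have "\<dots> \<le> m + 1 / (2 * real (Suc n)) + 2 * ((qnorm H w + C) * qnorm H d)"
      by (intro add_right_mono less_imp_le xE)
    finally show ?thesis unfolding d_def .
  qed
  moreover have "(\<lambda>n. m + 1 / (2 * real (Suc n)) + 2 * ((qnorm H w + C) * qnorm H (x n \<ominus> w)))
      \<longlonglongrightarrow> m + 1 / 2 * 0 + 2 * ((qnorm H w + C) * 0)"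
  proof (intro tendsto_add tendsto_mult tendsto_const dist0)
    have "(\<lambda>n. 1 / 2 * inverse (real (Suc n))) \<longlonglongrightarrow> 1 / 2 * 0"
      by (intro tendsto_mult tendsto_const LIMSEQ_inverse_real_of_nat)
    then show "(\<lambda>n. 1 / (2 * real (Suc n))) \<longlonglongrightarrow> 1 / 2 * 0"
      by (simp only: inverse_mult_distrib divide_inverse mult.assoc)
  qed
  ultimately have "E w \<le> m + 1 / 2 * 0 + 2 * ((qnorm H w + C) * 0)"
    by (intro LIMSEQ_le_const) blast+
  then have Ew: "E w \<le> m" by simp
  show ?thesis
  proof (intro bexI[OF _ w] ballI)
    fix u assume u: "u \<in> W"
    have "0 \<le> t * (2 * (rinner H w u - \<phi> u)) + t\<^sup>2 * (qnorm H u)\<^sup>2" for t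
      using m_le[of "w \<oplus> u \<odot>\<^sub>r of_real t"] Ew E_step[OF w u, of t] w u
      by (simp add: Wadd Wsm)
    then have "2 * (rinner H w u - \<phi> u) = 0" by (rule linear_coefficient_zero_of_nonneg)
    then show "rinner H w u = \<phi> u" by simp
  qed
qed

text \<open>
  The representation yields orthogonality of \<open>f - w\<close> to \<open>W\<close> for the real part only. As \<open>W\<close> is closed
  under right multiplication by quaternions, the other components vanish too.
\<close>

lemma qproj_properties:
  assumes W: "closed_right_subspace H W" and f: "f \<in> carrier H"
  shows qproj_in_subspace: "qproj H W f \<in> W"
    and qproj_orthogonal: "u \<in> W \<Longrightarrow> qinner H u (f \<ominus> qproj H W f) = 0"
proof -
  have WH: "\<And>u. u \<in> W \<Longrightarrow> u \<in> carrier H" and Wsm: "\<And>u q. u \<in> W \<Longrightarrow> u \<odot>\<^sub>r q \<in> W"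
    using W by (auto simp: closed_right_subspace_def)
  have "\<exists>w\<in>W. \<forall>u\<in>W. rinner H w u = rinner H f u"
  proof (rule real_functional_representation[OF W, of "rinner H f" "qnorm H f"])
    show "rinner H f (u \<oplus> v) = rinner H f u + rinner H f v" if "u \<in> W" "v \<in> W" for u v
      using that f WH by (simp add: qinner_add_right)
    show "rinner H f (u \<odot>\<^sub>r of_real r) = r * rinner H f u" if "u \<in> W" for u r
      using that f WH by (simp add: qinner_rsmult_right)
    show "\<bar>rinner H f u\<bar> \<le> qnorm H f * qnorm H u" if "u \<in> W" for u
      using that f WH by (intro rinner_Cauchy_Schwarz)
  qed
  then obtain w where w: "w \<in> W" and rep: "\<And>u. u \<in> W \<Longrightarrow> rinner H w u = rinner H f u"
    by blast
  have orth: "qinner H u (f \<ominus> w) = 0" if u: "u \<in> W" for u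
  proof -
    have "qinner H (f \<ominus> w) u = 0"
    proof (rule quat_eqI_Re0_mult)
      fix q
      have "rinner H (f \<ominus> w) (u \<odot>\<^sub>r q) = 0"
        using rep[OF Wsm[OF u]] f w u WH by (simp add: rinner_diff_left rsmult_closed)
      then show "Re0 (qinner H (f \<ominus> w) u * q) = Re0 (0 * q)"
        using f w u WH by (simp add: qinner_rsmult_right)
    qed
    then show ?thesis
      using qinner_cnj[of "f \<ominus> w" u] f w u WH by (simp add: qcnj_def zero_quat_def)
  qed
  have unique: "w' = w" if w': "w' \<in> W" "\<forall>u\<in>W. qinner H u (f \<ominus> w') = 0" for w'
  proof -
    define d where "d = w' \<ominus> w"
    have d: "d \<in> W" unfolding d_def using W w'(1) w by (rule closed_right_subspace_diff)
    have dH: "d \<in> carrier H" "w \<in> carrier H" "w' \<in> carrier H" using d w w'(1) WH by auto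
    have "qinner H d (f \<ominus> w') = 0" using w'(2) d by blast
    then have "rinner H d w' = rinner H d f"
      using dH f by (simp add: qinner_diff_right)
    moreover have "rinner H d w = rinner H d f"
      using rep[OF d] rinner_commute[OF dH(1,2)] rinner_commute[OF dH(1) f] by linarith
    ultimately have "rinner H d (w' \<ominus> w) = 0"
      using dH by (simp add: qinner_diff_right)
    then have "(qnorm H d)\<^sup>2 = 0"
      using dH by (simp add: qnorm_power2 flip: d_def)
    then show ?thesis
      using qnorm_diff_eq_0_iff[of w' w] w w'(1) WH by (simp add: d_def)
  qed
  have "qproj H W f = w"
    unfolding qproj_def using w orth unique by (intro the_equality) blast+
  then show "qproj H W f \<in> W" "u \<in> W \<Longrightarrow> qinner H u (f \<ominus> qproj H W f) = 0"
    using w orth by simp_all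
qed

lemma rinner_qproj:
  assumes W: "closed_right_subspace H W" and f: "f \<in> carrier H" and g: "g \<in> carrier H"
  shows "rinner H g (qproj H W f) = rinner H (qproj H W g) f"
proof -
  have in_H: "qproj H W f \<in> carrier H" "qproj H W g \<in> carrier H"
    using qproj_in_subspace[OF W] f g W by (auto simp: closed_right_subspace_def)
  have "rinner H (qproj H W g) f = rinner H (qproj H W g) (qproj H W f)"
    using qproj_orthogonal[OF W f qproj_in_subspace[OF W g]] in_H f
    by (simp add: qinner_diff_right)
  moreover have "rinner H (qproj H W f) g = rinner H (qproj H W f) (qproj H W g)"
    using qproj_orthogonal[OF W g qproj_in_subspace[OF W f]] in_H g
    by (simp add: qinner_diff_right)
  ultimately show ?thesis
    using rinner_commute[OF g in_H(1)] rinner_commute[OF in_H] by linarith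
qed

lemma bounded_right_linear_linear:
  assumes K: "right_quaternionic_hilbert_space K" and T: "bounded_right_linear H K T"
    and u: "u \<in> carrier H"
  shows bounded_right_linear_add: "v \<in> carrier H \<Longrightarrow> T (u \<oplus> v) = T u \<oplus>\<^bsub>K\<^esub> T v"
    and bounded_right_linear_rsmult: "T (u \<odot>\<^sub>r q) = T u \<odot>\<^sub>r\<^bsub>K\<^esub> q"
proof -
  interpret K: right_quaternionic_hilbert_space K by (rule K)
  have TK: "\<And>x. x \<in> carrier H \<Longrightarrow> T x \<in> carrier K"
    and lin: "\<And>\<alpha> \<beta> x y. x \<in> carrier H \<Longrightarrow> y \<in> carrier H \<Longrightarrow>
      T (x \<odot>\<^sub>r \<alpha> \<oplus> y \<odot>\<^sub>r \<beta>) = T x \<odot>\<^sub>r\<^bsub>K\<^esub> \<alpha> \<oplus>\<^bsub>K\<^esub> T y \<odot>\<^sub>r\<^bsub>K\<^esub> \<beta>"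
    using T by (auto simp: bounded_right_linear_def)
  show "T (u \<oplus> v) = T u \<oplus>\<^bsub>K\<^esub> T v" if v: "v \<in> carrier H"
    using lin[OF u v, of 1 1] u v by (simp add: rsmult_one K.rsmult_one TK)
  show "T (u \<odot>\<^sub>r q) = T u \<odot>\<^sub>r\<^bsub>K\<^esub> q"
    using lin[OF u u, of q 0] u
    by (simp add: rsmult_zero K.rsmult_zero TK rsmult_closed K.rsmult_closed)
qed

lemma qadjoint_properties:
  assumes K: "right_quaternionic_hilbert_space K" and T: "bounded_right_linear H K T"
    and v: "v \<in> carrier K"
  shows qadjoint_closed: "qadjoint H K T v \<in> carrier H"
    and qadjoint_inner: "u \<in> carrier H \<Longrightarrow> qinner H (qadjoint H K T v) u = qinner K v (T u)"
proof -
  interpret K: right_quaternionic_hilbert_space K by (rule K)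
  have TK: "\<And>x. x \<in> carrier H \<Longrightarrow> T x \<in> carrier K"
    using T by (auto simp: bounded_right_linear_def)
  obtain C where C: "\<And>x. x \<in> carrier H \<Longrightarrow> qnorm K (T x) \<le> C * qnorm H x"
    using T unfolding bounded_right_linear_def by blast
  note lin = bounded_right_linear_linear[OF K T]
  have bounded: "\<bar>rinner K v (T u)\<bar> \<le> qnorm K v * C * qnorm H u" if "u \<in> carrier H" for u
    using K.rinner_Cauchy_Schwarz[OF v TK[OF that]]
      mult_left_mono[OF C[OF that] K.qnorm_nonneg[OF v]]
    by (simp add: mult.assoc)
  have "\<exists>w\<in>carrier H. \<forall>u\<in>carrier H. rinner H w u = rinner K v (T u)"
  proof (rule real_functional_representation[OF closed_right_subspace_carrier,
        of "\<lambda>u. rinner K v (T u)" "qnorm K v * C"])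
    show "rinner K v (T (x \<oplus> y)) = rinner K v (T x) + rinner K v (T y)"
      if "x \<in> carrier H" "y \<in> carrier H" for x y
      using that v by (simp add: lin TK K.qinner_add_right)
    show "rinner K v (T (x \<odot>\<^sub>r of_real r)) = r * rinner K v (T x)" if "x \<in> carrier H" for x r
      using that v by (simp add: lin(2) TK K.qinner_rsmult_right)
  qed (use bounded in simp)
  then obtain w where w: "w \<in> carrier H"
    and rep: "\<And>u. u \<in> carrier H \<Longrightarrow> rinner H w u = rinner K v (T u)"
    by blast
  have inner: "qinner K v (T u) = qinner H w u" if u: "u \<in> carrier H" for u
  proof (rule quat_eqI_Re0_mult)
    fix q
    show "Re0 (qinner K v (T u) * q) = Re0 (qinner H w u * q)"
      using rep[of "u \<odot>\<^sub>r q"] u v w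
      by (simp add: lin TK K.qinner_rsmult_right qinner_rsmult_right rsmult_closed)
  qed
  have unique: "w' = w"
    if w': "w' \<in> carrier H" "\<forall>u\<in>carrier H. qinner K v (T u) = qinner H w' u" for w'
  proof -
    have "(qnorm H (w' \<ominus> w))\<^sup>2 = rinner H w' (w' \<ominus> w) - rinner H w (w' \<ominus> w)"
      using w w'(1) by (simp add: qnorm_power2 rinner_diff_left)
    also have "\<dots> = 0"
      using w'(2) inner[of "w' \<ominus> w"] w w'(1) by simp
    finally show ?thesis using qnorm_diff_eq_0_iff[of w' w] w w'(1) by simp
  qed
  have "qadjoint H K T v = w"
    unfolding qadjoint_def using w inner unique by (intro the_equality) blast+
  then show "qadjoint H K T v \<in> carrier H"
    "u \<in> carrier H \<Longrightarrow> qinner H (qadjoint H K T v) u = qinner K v (T u)"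
    using w inner by simp_all
qed

end

section \<open>Unconditional summation\<close>

context right_quaternionic_hilbert_space
begin

lemma rinner_finsum:
  assumes "g \<in> carrier H" "finite F" "\<And>j. j \<in> F \<Longrightarrow> x j \<in> carrier H"
  shows "rinner H g (finsum H x F) = (\<Sum>j\<in>F. rinner H g (x j))"
  using assms(2,3)
proof (induction F rule: finite_induct)
  case (insert a F)
  have "finsum H x F \<in> carrier H" using insert.prems by (intro finsum_closed) auto
  then show ?case
    using insert assms(1) by (simp add: finsum_insert Pi_iff qinner_add_right)
qed (use assms(1) in simp)

lemma qdist_finsum_subset:
  assumes FG: "finite G" "F \<subseteq> G" and x: "\<And>j. j \<in> G \<Longrightarrow> x j \<in> carrier H"
  shows "qdist H (finsum H x G) (finsum H x F) = qnorm H (finsum H x (G - F))"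
proof -
  have closed: "finsum H x A \<in> carrier H" if "A \<subseteq> G" for A
    using that x by (intro finsum_closed) auto
  have "finsum H x G = finsum H x (F \<union> (G - F))" using FG(2) by (simp add: Un_absorb1)
  also have "\<dots> = finsum H x F \<oplus> finsum H x (G - F)"
    using FG x by (intro finsum_Un_disjoint) (auto intro: finite_subset)
  finally have "finsum H x G \<ominus> finsum H x F = finsum H x (G - F)"
    using closed[of F] closed[of "G - F"] FG(2)
    by (simp add: minus_eq a_ac r_neg2 r_neg1)
  then show ?thesis using closed[of F] closed[of G] FG(2) by (simp add: qdist_def)
qed

lemma qhas_sum_unique: "qhas_sum H x I s \<Longrightarrow> qhas_sum H x I s' \<Longrightarrow> s = s'"
  unfolding qhas_sum_def by (rule limitin_qtopology_unique) auto

text \<open>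
  A diagonal choice of finite sets \<open>F n\<close> turns the Cauchy net into a Cauchy sequence. The \<open>F n\<close> need
  not increase: two of them are compared through their union.
\<close>

lemma qhas_sum_if_Cauchy:
  assumes x: "\<And>j. j \<in> I \<Longrightarrow> x j \<in> carrier H"
    and Cauchy: "\<And>e. e > 0 \<Longrightarrow>
      \<exists>F. finite F \<and> F \<subseteq> I \<and> (\<forall>D. finite D \<and> D \<subseteq> I - F \<longrightarrow> (qnorm H (finsum H x D))\<^sup>2 < e)"
  shows "\<exists>s. qhas_sum H x I s"
proof -
  have closed: "finsum H x A \<in> carrier H" if "A \<subseteq> I" for A
    using that x by (intro finsum_closed) auto
  have "\<exists>F. finite F \<and> F \<subseteq> I \<and>
      (\<forall>D. finite D \<and> D \<subseteq> I - F \<longrightarrow> (qnorm H (finsum H x D))\<^sup>2 < 1 / real (Suc n))" for n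
    using Cauchy[of "1 / real (Suc n)"] by simp
  then obtain F where F: "\<And>n. finite (F n)" "\<And>n. F n \<subseteq> I"
    and tail: "\<And>n D. finite D \<Longrightarrow> D \<subseteq> I - F n \<Longrightarrow>
      (qnorm H (finsum H x D))\<^sup>2 < 1 / real (Suc n)"
    by metis
  have near: "(qdist H (finsum H x G) (finsum H x (F n)))\<^sup>2 < 1 / real (Suc n)"
    if "finite G" "F n \<subseteq> G" "G \<subseteq> I" for G n
  proof -
    have "qdist H (finsum H x G) (finsum H x (F n)) = qnorm H (finsum H x (G - F n))"
      using that x by (intro qdist_finsum_subset) auto
    then show ?thesis using tail[of "G - F n" n] that by auto
  qed
  have "(qdist H (finsum H x (F n)) (finsum H x (F k)))\<^sup>2 \<le> 2 / real (Suc n) + 2 / real (Suc k)"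
    for n k
  proof -
    define G a b where "G = F n \<union> F k"
      and "a = qdist H (finsum H x G) (finsum H x (F n))"
      and "b = qdist H (finsum H x G) (finsum H x (F k))"
    have ab: "a\<^sup>2 < 1 / real (Suc n)" "b\<^sup>2 < 1 / real (Suc k)"
      using near[of G n] near[of G k] F unfolding a_def b_def by (simp_all add: G_def)
    have "qdist H (finsum H x (F n)) (finsum H x (F k)) \<le> a + b"
      using metric.triangle[of "finsum H x (F n)" "finsum H x G" "finsum H x (F k)"] F closed
      by (simp add: a_def b_def G_def metric.commute)
    then have "(qdist H (finsum H x (F n)) (finsum H x (F k)))\<^sup>2 \<le> (a + b)\<^sup>2"
      by (intro power_mono) auto
    also have "\<dots> \<le> 2 * a\<^sup>2 + 2 * b\<^sup>2"
      using zero_le_power2[of "a - b"] by (simp add: power2_sum power2_diff)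
    also have "\<dots> \<le> 2 * (1 / real (Suc n)) + 2 * (1 / real (Suc k))" using ab by linarith
    finally show ?thesis by simp
  qed
  then obtain s where lim: "limitin (qtopology H) (\<lambda>n. finsum H x (F n)) s sequentially"
    using limit_of_fast_Cauchy[of "\<lambda>n. finsum H x (F n)"] closed F(2) by blast
  then have s: "s \<in> carrier H" by (simp add: limitin_qtopology_iff)
  have "\<forall>\<^sub>F G in finite_subsets_at_top I. finsum H x G \<in> carrier H \<and> qdist H (finsum H x G) s < \<epsilon>"
    if \<epsilon>: "\<epsilon> > 0" for \<epsilon>
  proof -
    obtain N where N: "inverse (real (Suc N)) < (\<epsilon> / 2)\<^sup>2"
      using reals_Archimedean[of "(\<epsilon> / 2)\<^sup>2"] \<epsilon> by auto
    have "\<forall>\<^sub>F n in sequentially. finsum H x (F n) \<in> carrier H \<and> qdist H (finsum H x (F n)) s < \<epsilon> / 2"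
      using lim \<epsilon> half_gt_zero[OF \<epsilon>] unfolding limitin_qtopology_iff by blast
    then obtain n where n: "n \<ge> N" "qdist H (finsum H x (F n)) s < \<epsilon> / 2"
      unfolding eventually_sequentially by (meson nat_le_linear)
    have "qdist H (finsum H x G) s < \<epsilon>" if G: "finite G" "F n \<subseteq> G" "G \<subseteq> I" for G
    proof -
      have "1 / real (Suc n) \<le> inverse (real (Suc N))"
        using n(1) by (simp add: inverse_eq_divide frac_le)
      then have "(qdist H (finsum H x G) (finsum H x (F n)))\<^sup>2 < (\<epsilon> / 2)\<^sup>2"
        using near[OF G] N by linarith
      then have "qdist H (finsum H x G) (finsum H x (F n)) < \<epsilon> / 2"
        using \<epsilon> by (intro power_less_imp_less_base[of _ 2 "\<epsilon> / 2"]) auto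
      then show ?thesis
        using metric.triangle[of "finsum H x G" "finsum H x (F n)" s] closed F(2) G(3) s n(2)
        by fastforce
    qed
    then show ?thesis
      using F closed unfolding eventually_finite_subsets_at_top by (intro exI[of _ "F n"]) auto
  qed
  then show ?thesis
    using s unfolding qhas_sum_def limitin_qtopology_iff by blast
qed

text \<open>
  The partial sums of a convergent real family eventually change by less than any given amount,
  and the bound passes this on to the vectors.
\<close>

lemma qhas_sum_if_square_bound:
  fixes a :: "'i \<Rightarrow> real"
  assumes x: "\<And>j. j \<in> I \<Longrightarrow> x j \<in> carrier H"
    and a: "(a has_sum s) I"
    and bound: "\<And>D. finite D \<Longrightarrow> D \<subseteq> I \<Longrightarrow> (qnorm H (finsum H x D))\<^sup>2 \<le> B * sum a D"
  shows "\<exists>l. qhas_sum H x I l"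
proof (rule qhas_sum_if_Cauchy[OF x])
  fix e :: real assume e: "e > 0"
  define \<delta> where "\<delta> = e / (2 * (\<bar>B\<bar> + 1))"
  have \<delta>: "\<delta> > 0" using e by (simp add: \<delta>_def)
  obtain F where F: "finite F" "F \<subseteq> I"
    and near: "\<forall>G. finite G \<and> F \<subseteq> G \<and> G \<subseteq> I \<longrightarrow> dist (sum a G) s < \<delta>"
    using tendstoD[OF a[unfolded has_sum_def] \<delta>] unfolding eventually_finite_subsets_at_top
    by (elim exE conjE)
  have "(qnorm H (finsum H x D))\<^sup>2 < e" if D: "finite D" "D \<subseteq> I - F" for D
  proof -
    have "sum a (F \<union> D) = sum a F + sum a D"
      using F D by (intro sum.union_disjoint) auto
    moreover have "dist (sum a (F \<union> D)) s < \<delta>" "dist (sum a F) s < \<delta>"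
      using near F D by auto
    ultimately have small: "\<bar>sum a D\<bar> < 2 * \<delta>" by (simp add: dist_real_def)
    have "(qnorm H (finsum H x D))\<^sup>2 \<le> B * sum a D" using D by (intro bound) auto
    also have "\<dots> \<le> \<bar>B\<bar> * \<bar>sum a D\<bar>" by (metis abs_ge_self abs_mult)
    also have "\<dots> \<le> \<bar>B\<bar> * (2 * \<delta>)" using small by (intro mult_left_mono) auto
    also have "\<dots> < (\<bar>B\<bar> + 1) * (2 * \<delta>)" using \<delta> by (intro mult_strict_right_mono) auto
    also have "\<dots> = e" by (simp add: \<delta>_def field_simps)
    finally show ?thesis .
  qed
  then show "\<exists>F. finite F \<and> F \<subseteq> I \<and>
      (\<forall>D. finite D \<and> D \<subseteq> I - F \<longrightarrow> (qnorm H (finsum H x D))\<^sup>2 < e)"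
    using F by blast
qed

lemma tendsto_rinner:
  assumes lim: "limitin (qtopology H) x l F" and g: "g \<in> carrier H"
  shows "((\<lambda>n. rinner H g (x n)) \<longlongrightarrow> rinner H g l) F"
proof (rule tendstoI)
  fix e :: real assume e: "e > 0"
  have l: "l \<in> carrier H" using lim by (simp add: limitin_qtopology_iff)
  have pos: "qnorm H g + 1 > 0" using qnorm_nonneg[OF g] by simp
  have "\<forall>\<^sub>F n in F. x n \<in> carrier H \<and> qdist H (x n) l < e / (qnorm H g + 1)"
    using lim e pos by (simp add: limitin_qtopology_iff)
  then show "\<forall>\<^sub>F n in F. dist (rinner H g (x n)) (rinner H g l) < e"
  proof eventually_elim
    case (elim n)
    have "dist (rinner H g (x n)) (rinner H g l) = \<bar>rinner H g (x n \<ominus> l)\<bar>"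
      using elim l g by (simp add: dist_real_def qinner_diff_right)
    also have "\<dots> \<le> qnorm H g * qdist H (x n) l"
      using rinner_Cauchy_Schwarz[OF g, of "x n \<ominus> l"] elim l by (simp add: qdist_def)
    also have "\<dots> \<le> (qnorm H g + 1) * qdist H (x n) l"
      by (intro mult_right_mono) auto
    also have "\<dots> < (qnorm H g + 1) * (e / (qnorm H g + 1))"
      using elim pos by (intro mult_strict_left_mono) auto
    finally show ?case using pos by simp
  qed
qed

end

section \<open>The frame operator\<close>

locale g_fusion_system = right_quaternionic_hilbert_space H
  for H :: "('a, 'm) right_qspace_scheme" (structure) +
  fixes J :: "int set"
    and K :: "int \<Rightarrow> ('b, 'n) right_qspace_scheme"
    and W :: "int \<Rightarrow> 'a set"
    and \<Lambda> :: "int \<Rightarrow> 'a \<Rightarrow> 'b"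
    and v :: "int \<Rightarrow> real"
  assumes K: "j \<in> J \<Longrightarrow> right_quaternionic_hilbert_space (K j)"
    and family: "g_fusion_family H J K W \<Lambda> v"
begin

abbreviation component :: "int \<Rightarrow> 'a \<Rightarrow> 'b"
  where "component j f \<equiv> \<Lambda> j (qproj H (W j) f)"

abbreviation energy :: "'a \<Rightarrow> int \<Rightarrow> real"
  where "energy f j \<equiv> (v j)\<^sup>2 * (qnorm (K j) (component j f))\<^sup>2"

definition frame_term :: "'a \<Rightarrow> int \<Rightarrow> 'a"
  where "frame_term f j =
    qproj H (W j) (qadjoint H (K j) (\<Lambda> j) (component j f)) \<odot>\<^sub>r of_real ((v j)\<^sup>2)"

lemma family_props:
  assumes "j \<in> J"
  shows W_closed: "closed_right_subspace H (W j)"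
    and \<Lambda>_bounded: "bounded_right_linear H (K j) (\<Lambda> j)"
  using family assms by (auto simp: g_fusion_family_def)

lemma qproj_closed:
  assumes "j \<in> J" "f \<in> carrier H"
  shows "qproj H (W j) f \<in> carrier H"
  using qproj_in_subspace[OF W_closed[OF assms(1)] assms(2)] W_closed[OF assms(1)]
  unfolding closed_right_subspace_def by blast

lemma component_closed:
  assumes "j \<in> J" "f \<in> carrier H"
  shows "component j f \<in> carrier (K j)"
  using \<Lambda>_bounded[OF assms(1)] qproj_closed[OF assms] unfolding bounded_right_linear_def by blast

lemma adjoint_component_closed:
  assumes "j \<in> J" "f \<in> carrier H"
  shows "qadjoint H (K j) (\<Lambda> j) (component j f) \<in> carrier H"
  using assms by (intro qadjoint_closed K \<Lambda>_bounded component_closed)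

lemma frame_term_closed:
  assumes "j \<in> J" "f \<in> carrier H"
  shows "frame_term f j \<in> carrier H"
  unfolding frame_term_def using assms by (intro rsmult_closed qproj_closed adjoint_component_closed)

text \<open>
  This identity makes the frame operator symmetric and positive, and ties its quadratic form to
  the sum in the definition of a frame.
\<close>

lemma rinner_frame_term:
  assumes j: "j \<in> J" and f: "f \<in> carrier H" and g: "g \<in> carrier H"
  shows "rinner H g (frame_term f j) = (v j)\<^sup>2 * rinner (K j) (component j g) (component j f)"
proof -
  interpret Kj: right_quaternionic_hilbert_space "K j" by (rule K[OF j])
  let ?a = "qadjoint H (K j) (\<Lambda> j) (component j f)"
  have a: "?a \<in> carrier H" and Pg: "qproj H (W j) g \<in> carrier H"
    using j f g by (simp_all add: adjoint_component_closed qproj_closed)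
  have "rinner H g (qproj H (W j) ?a) = rinner H (qproj H (W j) g) ?a"
    using a g by (rule rinner_qproj[OF W_closed[OF j]])
  also have "\<dots> = rinner H ?a (qproj H (W j) g)" using Pg a by (rule rinner_commute)
  also have "\<dots> = rinner (K j) (component j f) (component j g)"
    using qadjoint_inner[OF K[OF j] \<Lambda>_bounded[OF j] component_closed[OF j f] Pg] by simp
  also have "\<dots> = rinner (K j) (component j g) (component j f)"
    using j f g by (intro Kj.rinner_commute component_closed)
  finally show ?thesis
    using qinner_rsmult_right[OF g qproj_closed[OF j a]]
    by (simp add: frame_term_def del: of_real_power)
qed

lemma rinner_frame_term_self:
  assumes "j \<in> J" "f \<in> carrier H"
  shows "rinner H f (frame_term f j) = energy f j"
  using assms
  by (simp add: rinner_frame_term component_closed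
      right_quaternionic_hilbert_space.qnorm_power2[OF K])

lemma partial_sum_closed:
  assumes "F \<subseteq> J" "f \<in> carrier H"
  shows "finsum H (frame_term f) F \<in> carrier H"
  using assms by (intro finsum_closed) (auto intro: frame_term_closed)

lemma rinner_partial_sum_self:
  assumes "finite F" "F \<subseteq> J" "f \<in> carrier H"
  shows "rinner H f (finsum H (frame_term f) F) = sum (energy f) F"
proof -
  have "rinner H f (finsum H (frame_term f) F) = (\<Sum>j\<in>F. rinner H f (frame_term f j))"
    using assms by (intro rinner_finsum) (auto intro: frame_term_closed)
  also have "\<dots> = sum (energy f) F"
    using assms by (intro sum.cong rinner_frame_term_self) auto
  finally show ?thesis .
qed

lemma energy_sum_le:
  assumes "(energy f has_sum s) J" "finite F" "F \<subseteq> J"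
  shows "sum (energy f) F \<le> s"
proof (rule has_sum_mono_neutral[OF has_sum_finite[OF assms(2)] assms(1)])
  show "energy f j \<le> 0" if "j \<in> F - J" for j using that assms(3) by blast
qed simp_all

text \<open>
  Testing the partial sum \<open>x\<close> against itself brings in the energies of \<open>x\<close>, whose total the upper
  frame bound limits by \<open>B\<close> times \<open>(qnorm H x)\<^sup>2\<close>; one such factor then cancels.
\<close>

lemma partial_sum_bound:
  assumes bounds: "g_fusion_bounds H J K W \<Lambda> v A B" and B: "0 \<le> B"
    and F: "finite F" "F \<subseteq> J" and f: "f \<in> carrier H"
  shows "(qnorm H (finsum H (frame_term f) F))\<^sup>2 \<le> B * sum (energy f) F"
proof -
  define x where "x = finsum H (frame_term f) F"
  define n where "n = (qnorm H x)\<^sup>2"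
  have x: "x \<in> carrier H" using F f by (simp add: x_def partial_sum_closed)
  obtain s where "(energy x has_sum s) J" "s \<le> B * (qnorm H x)\<^sup>2"
    using bounds x unfolding g_fusion_bounds_def by blast
  then have energy_x: "sum (energy x) F \<le> B * n"
    using energy_sum_le F unfolding n_def by fastforce
  have E: "0 \<le> sum (energy f) F" by (intro sum_nonneg) simp
  have "n = rinner H x (finsum H (frame_term f) F)"
    using x by (simp add: n_def qnorm_power2 flip: x_def)
  also have "\<dots> = (\<Sum>j\<in>F. rinner H x (frame_term f j))"
    using x F f by (intro rinner_finsum) (auto intro: frame_term_closed)
  also have "\<dots> \<le> (\<Sum>j\<in>F. (v j * qnorm (K j) (component j x)) * (v j * qnorm (K j) (component j f)))"
  proof (rule sum_mono)
    fix j assume "j \<in> F"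
    then have j: "j \<in> J" using F by auto
    interpret Kj: right_quaternionic_hilbert_space "K j" by (rule K[OF j])
    have "rinner H x (frame_term f j)
        \<le> (v j)\<^sup>2 * (qnorm (K j) (component j x) * qnorm (K j) (component j f))"
      unfolding rinner_frame_term[OF j f x]
      using Kj.rinner_Cauchy_Schwarz[OF component_closed[OF j x] component_closed[OF j f]]
      by (intro mult_left_mono) auto
    then show "rinner H x (frame_term f j)
        \<le> (v j * qnorm (K j) (component j x)) * (v j * qnorm (K j) (component j f))"
      by (simp only: power2_eq_square mult_ac)
  qed
  finally have "n\<^sup>2 \<le> (\<Sum>j\<in>F. (v j * qnorm (K j) (component j x)) * (v j * qnorm (K j) (component j f)))\<^sup>2"
    by (intro power_mono) (simp_all add: n_def)
  also have "\<dots> \<le> (\<Sum>j\<in>F. (v j * qnorm (K j) (component j x))\<^sup>2) * (\<Sum>j\<in>F. (v j * qnorm (K j) (component j f))\<^sup>2)"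
    by (rule Cauchy_Schwarz_ineq_sum)
  also have "\<dots> = sum (energy x) F * sum (energy f) F" by (simp only: power_mult_distrib)
  also have "\<dots> \<le> B * n * sum (energy f) F" using energy_x E by (rule mult_right_mono)
  finally have "n * n \<le> n * (B * sum (energy f) F)" by (simp add: power2_eq_square mult_ac)
  then have "n = 0 \<or> n \<le> B * sum (energy f) F"
    unfolding mult_le_cancel_left using zero_le_power2[of "qnorm H x"] by (fold n_def) linarith
  then have "n \<le> B * sum (energy f) F"
    using mult_nonneg_nonneg[OF B E] by linarith
  then show ?thesis by (simp add: n_def x_def)
qed

lemma g_fusion_frame_operator_eqI:
  "qhas_sum H (frame_term f) J g \<Longrightarrow> g_fusion_frame_operator H J K W \<Lambda> v f = g"
  unfolding g_fusion_frame_operator_def frame_term_def[symmetric]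
  by (intro the_equality) (auto intro: qhas_sum_unique)

text \<open>
  The frame operator is defined by a description, so its value says nothing about the series until
  convergence is known.
\<close>

lemma frame_operator_has_sum:
  assumes bounds: "g_fusion_bounds H J K W \<Lambda> v A B" and B: "0 \<le> B" and f: "f \<in> carrier H"
  shows "qhas_sum H (frame_term f) J (g_fusion_frame_operator H J K W \<Lambda> v f)"
proof -
  obtain s where "(energy f has_sum s) J"
    using bounds f unfolding g_fusion_bounds_def by blast
  then obtain g where "qhas_sum H (frame_term f) J g"
    using qhas_sum_if_square_bound[of J "frame_term f" "energy f" s B] frame_term_closed
      partial_sum_bound[OF bounds B] f by blast
  then show ?thesis using g_fusion_frame_operator_eqI by simp
qed

lemma energy_has_sum_rinner_frame_operator:
  assumes "g_fusion_bounds H J K W \<Lambda> v A B" "0 \<le> B" and f: "f \<in> carrier H"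
  shows "(energy f has_sum rinner H f (g_fusion_frame_operator H J K W \<Lambda> v f)) J"
proof -
  have "((\<lambda>F. rinner H f (finsum H (frame_term f) F)) \<longlongrightarrow>
      rinner H f (g_fusion_frame_operator H J K W \<Lambda> v f)) (finite_subsets_at_top J)"
    using frame_operator_has_sum[OF assms] f unfolding qhas_sum_def by (rule tendsto_rinner)
  moreover have "\<forall>\<^sub>F F in finite_subsets_at_top J.
      rinner H f (finsum H (frame_term f) F) = sum (energy f) F"
    by (intro eventually_finite_subsets_at_top_weakI rinner_partial_sum_self f)
  ultimately show ?thesis
    unfolding has_sum_def by (rule Lim_transform_eventually)
qed

text \<open>
  With bound 1, the squared error of a partial sum is at most the energy that it has not yet
  collected.
\<close>

lemma parseval_imp_qhas_sum_self:
  assumes parseval: "g_fusion_bounds H J K W \<Lambda> v 1 1" and f: "f \<in> carrier H"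
  shows "qhas_sum H (frame_term f) J f"
proof -
  obtain s where "(energy f has_sum s) J" "1 * (qnorm H f)\<^sup>2 \<le> s" "s \<le> 1 * (qnorm H f)\<^sup>2"
    using parseval f unfolding g_fusion_bounds_def by blast
  then have sum_f: "(energy f has_sum (qnorm H f)\<^sup>2) J"
    by simp
  have "\<forall>\<^sub>F F in finite_subsets_at_top J.
      finsum H (frame_term f) F \<in> carrier H \<and> qdist H (finsum H (frame_term f) F) f < \<epsilon>"
    if \<epsilon>: "\<epsilon> > 0" for \<epsilon>
  proof -
    have "\<forall>\<^sub>F F in finite_subsets_at_top J. (qnorm H f)\<^sup>2 - \<epsilon>\<^sup>2 < sum (energy f) F"
      using sum_f \<epsilon> unfolding has_sum_def by (intro order_tendstoD(1)) auto
    moreover have "\<forall>\<^sub>F F in finite_subsets_at_top J. finite F \<and> F \<subseteq> J"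
      by (auto intro: eventually_finite_subsets_at_top_weakI)
    ultimately show ?thesis
    proof eventually_elim
      case (elim F)
      define x where "x = finsum H (frame_term f) F"
      have x: "x \<in> carrier H" using elim f by (simp add: x_def partial_sum_closed)
      have "(qdist H x f)\<^sup>2 = (qnorm H x)\<^sup>2 - 2 * rinner H f x + (qnorm H f)\<^sup>2"
        using x f by (simp add: qdist_def qnorm_diff_power2 rinner_commute[of x f])
      also have "\<dots> \<le> (qnorm H f)\<^sup>2 - sum (energy f) F"
        using partial_sum_bound[OF parseval _ _ _ f, of F] rinner_partial_sum_self[of F f] elim f
        by (simp add: x_def)
      also have "\<dots> < \<epsilon>\<^sup>2" using elim by simp
      finally have "qdist H x f < \<epsilon>"
        using \<epsilon> by (intro power_less_imp_less_base[of _ 2 \<epsilon>]) auto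
      then show ?case using x by (simp add: x_def)
    qed
  qed
  then show ?thesis using f unfolding qhas_sum_def limitin_qtopology_iff by blast
qed

end

theorem theorem4p8:
  fixes H :: "('a, 'm) right_qspace_scheme"
    and J :: "int set"
    and K :: "int \<Rightarrow> ('b, 'n) right_qspace_scheme"
    and W :: "int \<Rightarrow> 'a set"
    and \<Lambda> :: "int \<Rightarrow> 'a \<Rightarrow> 'b"
    and v :: "int \<Rightarrow> real"
  assumes "right_quaternionic_hilbert_space H"
    and "separable_space (qtopology H)"
    and "\<And>j. j \<in> J \<Longrightarrow> right_quaternionic_hilbert_space (K j)"
    and "g_fusion_frame H J K W \<Lambda> v"
  shows "parseval_g_fusion_frame H J K W \<Lambda> v \<longleftrightarrow>
    (\<forall>f\<in>carrier H. g_fusion_frame_operator H J K W \<Lambda> v f = f)"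
proof -
  obtain A B where family: "g_fusion_family H J K W \<Lambda> v"
    and AB: "0 < A" "A \<le> B" and bounds: "g_fusion_bounds H J K W \<Lambda> v A B"
    using assms(4) unfolding g_fusion_frame_def by blast
  interpret g_fusion_system H J K W \<Lambda> v
    using assms(1,3) family by (intro g_fusion_system.intro g_fusion_system_axioms.intro)
  show ?thesis
  proof
    assume "parseval_g_fusion_frame H J K W \<Lambda> v"
    then show "\<forall>f\<in>carrier H. g_fusion_frame_operator H J K W \<Lambda> v f = f"
      unfolding parseval_g_fusion_frame_def
      by (blast intro: g_fusion_frame_operator_eqI parseval_imp_qhas_sum_self)
  next
    assume S: "\<forall>f\<in>carrier H. g_fusion_frame_operator H J K W \<Lambda> v f = f"
    have "(energy f has_sum (qnorm H f)\<^sup>2) J" if f: "f \<in> carrier H" for f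
      using energy_has_sum_rinner_frame_operator[OF bounds _ f] AB S f
      by (simp add: qnorm_power2)
    then have "g_fusion_bounds H J K W \<Lambda> v 1 1"
      unfolding g_fusion_bounds_def by fastforce
    then show "parseval_g_fusion_frame H J K W \<Lambda> v"
      using family by (simp add: parseval_g_fusion_frame_def)
  qed
qed

end
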